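(* Let $J\subset I$. A non zero element of $\mathfrak{K}_{J,t}^\infty$ has at least one $J$-dominant monomial.
   Context: Cartan data. $I=\{1,\dots,n\}$, $C=(C_{i,j})$ a Cartan matrix of finite type, $r_i\in\mathbb{N}^*$ with $(r_iC_{i,j})$ symmetric, coprime on each indecomposable component. $z$ is an indeterminate, $[l]_z=\frac{z^l-z^{-l}}{z-z^{-1}}$, $C(z)_{i,i}=z^{r_i}+z^{-r_i}$, $C(z)_{i,j}=[C_{i,j}]_z$ ($i\neq j$), $\tilde C(z)=C(z)^{-1}$; $(\tilde C_{i,j})_r\in\mathbb{Z}$ is the coefficient of $z^r$ in the expansion of $\tilde C_{i,j}(z)$ in $\mathbb{Z}((z^{-1}))$. Monomials. $\mathcal{Y}=\mathbb{Z}[Y_{i,l}^{\pm1}]_{i\in I,l\in\mathbb{Z}}$ (commutative), $A$ is its set of Laurent monomials $m=\prod Y_{i,l}^{u_{i,l}(m)}$, and $$A_{i,l}=Y_{i,l-r_i}Y_{i,l+r_i}\prod_{C_{j,i}=-1}Y_{j,l}^{-1}\prod_{C_{j,i}=-2}Y_{j,l+1}^{-1}Y_{j,l-1}^{-1}\prod_{C_{j,i}=-3}Y_{j,l+2}^{-1}Y_{j,l}^{-1}Y_{j,l-2}^{-1}.$$ $B_i=\{m\in A:u_{i,l}(m)\ge0\ \forall l\}$, $B_J=\bigcap_{i\in J}B_i$ ($J$-dominant monomials). The algebra $\mathcal{Y}_t$. It is the free $\mathbb{Z}[t^{\pm1}]$-module with basis $\{:\!m\!:\,\mid m\in A\}$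 and $\mathbb{Z}[t^{\pm1}]$-bilinear associative product $:\!m_1\!:\,:\!m_2\!:\,=t^{\mathcal{N}(m_1,m_2)}:\!m_1m_2\!:$, where $\mathcal{N}:A\times A\to\mathbb{Z}$ is the bicharacter with $\mathcal{N}(Y_{i,l},Y_{j,k})=(\tilde C_{j,i})_{r_j+l-k}-(\tilde C_{j,i})_{-r_j+l-k}$. Put $\tilde Y_{i,l}=:\!Y_{i,l}\!:$, $\tilde A_{i,l}=:\!A_{i,l}\!:$ (invertible, $\tilde A_{i,l}^{-1}=:\!A_{i,l}^{-1}\!:$). The monomials of an element are the $m\in A$ such that $:\!m\!:$ has nonzero coefficient. $\overset{\rightarrow}{\prod}_{l}$ is the product ordered by increasing $l$. Completions. For $m\in B_i$ put $E_{i,t}(m)=\overset{\rightarrow}{\prod}_{l\in\mathbb{Z}}\bigl((\tilde Y_{i,l}(1+t\tilde A_{i,l+r_i}^{-1}))^{u_{i,l}(m)}\prod_{j\ne i}\tilde Y_{j,l}^{u_{j,l}(m)}\bigr)$. Let $\mathcal{Y}_t^{A,K}$ be the $\mathbb{Z}[t^{\pm1}]$-span of the $:\!a\!:$ with $a$ a product of $K$ elements $A_{j,l}^{-1}$, $\mathcal{Y}_t^{A,\infty}=\prod_{K\ge0}\mathcal{Y}_t^{A,K}$, and $\mathcal{Y}_t^\infty=\sum_{M\in A}:\!M\!:\mathcal{Y}_t^{A,\infty}\subset\prod_{m\in A}\mathbb{Z}[t^{\pm1}]:\!m\!:$ (finite sums over $M$). $\mathfrak{K}_{i,t}^\infty\subset\mathcal{Y}_t^\infty$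 is the set of finite sums, over $M\in A$, of elements $\sum_{K\ge0}\sum_a\lambda_a(t)E_{i,t}(Ma)$, where for each $K$ the inner sum is over finitely many products $a$ of $K$ elements $A_{j,l}^{-1}$ with $Ma\in B_i$, $\lambda_a(t)\in\mathbb{Z}[t^{\pm1}]$. For $J\subset I$, $\mathfrak{K}_{J,t}^\infty=\bigcap_{i\in J}\mathfrak{K}_{i,t}^\infty\subset\mathcal{Y}_t^\infty$. *)

theory Defs
  imports
    "HOL-Analysis.Cartesian_Space"
    "HOL-Analysis.Determinants"
    "HOL-Computational_Algebra.Formal_Laurent_Series"
    "HOL-Library.Poly_Mapping"
    "HOL-Algebra.Ring"
begin

section \<open>Cartan data\<close>

text \<open>
  The index set \<open>I = {1, \<dots>, n}\<close> is the set of elements of a finite linearly ordered type.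
  The principal minors are given by the Leibniz formula, as in the definition of
  \<^const>\<open>det\<close>.
\<close>

definition principal_minor :: "int ^ 'i ^ 'i \<Rightarrow> 'i set \<Rightarrow> int" where
  "principal_minor C S = (\<Sum>p | p permutes S. sign p * (\<Prod>i\<in>S. C $ i $ p i))"

definition finite_type_Cartan :: "int ^ 'i ^ 'i \<Rightarrow> bool" where
  "finite_type_Cartan C \<longleftrightarrow>
     (\<forall>i. C $ i $ i = 2) \<and>
     (\<forall>i j. i \<noteq> j \<longrightarrow> C $ i $ j \<le> 0) \<and>
     (\<forall>i j. C $ i $ j = 0 \<longleftrightarrow> C $ j $ i = 0) \<and>
     (\<forall>S. principal_minor C S > 0)"

definition indec_component :: "int ^ 'i ^ 'i \<Rightarrow> 'i \<Rightarrow> 'i set" where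
  "indec_component C i = {j. (i, j) \<in> {(a, b). C $ a $ b \<noteq> 0}\<^sup>*}"

definition Cartan_symmetrizer :: "int ^ 'i ^ 'i \<Rightarrow> ('i \<Rightarrow> nat) \<Rightarrow> bool" where
  "Cartan_symmetrizer C r \<longleftrightarrow>
     (\<forall>i. r i > 0) \<and>
     (\<forall>i j. int (r i) * C $ i $ j = int (r j) * C $ j $ i) \<and>
     (\<forall>i. Gcd (r ` indec_component C i) = 1)"

text \<open>
  The ring \<open>\<int>((z\<^sup>-\<^sup>1))\<close> is the type \<^typ>\<open>int fls\<close>, whose formal variable stands for
  \<open>z\<^sup>-\<^sup>1\<close>: the power \<open>z\<^sup>k\<close> is the variable to the power \<open>- k\<close>, and the
  coefficient of \<open>z\<^sup>k\<close> is the one of index \<open>- k\<close>.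
\<close>

definition zpow :: "int \<Rightarrow> int fls" where
  "zpow k = fls_X_intpow (- k)"

definition zcoeff :: "int fls \<Rightarrow> int \<Rightarrow> int" where
  "zcoeff f k = fls_nth f (- k)"

text \<open>The quotient below exists, and it is unique because \<^typ>\<open>int fls\<close> is a domain.\<close>

definition zint :: "int \<Rightarrow> int fls" where
  "zint l = (THE q. q * (zpow 1 - zpow (- 1)) = zpow l - zpow (- l))"

definition zCartan :: "int ^ 'i ^ 'i \<Rightarrow> ('i \<Rightarrow> nat) \<Rightarrow> int fls ^ 'i ^ 'i" where
  "zCartan C r = (\<chi> i j. if i = j then zpow (int (r i)) + zpow (- int (r i)) else zint (C $ i $ j))"

text \<open>
  For a Cartan matrix of finite type the determinant of \<open>C(z)\<close> has leading term
  \<open>z\<close> to the power \<open>\<Sum>i. r i\<close> with coefficient 1, so \<open>C(z)\<close> is invertible over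
  \<open>\<int>((z\<^sup>-\<^sup>1))\<close>, and its inverse there is the expansion of its inverse over \<open>\<rat>(z)\<close>.
\<close>

definition zCartan_inv :: "int ^ 'i ^ 'i \<Rightarrow> ('i \<Rightarrow> nat) \<Rightarrow> int fls ^ 'i ^ 'i" where
  "zCartan_inv C r = matrix_inv (zCartan C r)"


section \<open>Monomials\<close>

text \<open>
  The Laurent monomial \<open>m\<close> is given by its exponents \<open>u\<^bsub>i,l\<^esub>(m)\<close>, and the group of
  monomials is written additively.
\<close>

type_synonym 'i mon = "('i \<times> int) \<Rightarrow>\<^sub>0 int"

definition Ymon :: "'i \<Rightarrow> int \<Rightarrow> 'i mon" where
  "Ymon i l = Poly_Mapping.single (i, l) 1"

definition Amon :: "int ^ 'i ^ 'i \<Rightarrow> ('i \<Rightarrow> nat) \<Rightarrow> 'i \<Rightarrow> int \<Rightarrow> 'i mon" where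
  "Amon C r i l =
     Ymon i (l - int (r i)) + Ymon i (l + int (r i))
     - (\<Sum>j | C $ j $ i = - 1. Ymon j l)
     - (\<Sum>j | C $ j $ i = - 2. Ymon j (l + 1) + Ymon j (l - 1))
     - (\<Sum>j | C $ j $ i = - 3. Ymon j (l + 2) + Ymon j l + Ymon j (l - 2))"

definition dominant :: "'i set \<Rightarrow> 'i mon set" where
  "dominant J = {m. \<forall>i\<in>J. \<forall>l. Poly_Mapping.lookup m (i, l) \<ge> 0}"

definition Ainv_products :: "int ^ 'i ^ 'i \<Rightarrow> ('i \<Rightarrow> nat) \<Rightarrow> nat \<Rightarrow> 'i mon set" where
  "Ainv_products C r K =
     {a. \<exists>s :: ('i \<times> int) list. length s = K \<and> a = (\<Sum>(j, l)\<leftarrow>s. - Amon C r j l)}"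


section \<open>The algebra $\mathcal{Y}_t$\<close>

text \<open>
  The ring \<open>\<int>[t\<^sup>\<plusminus>\<^sup>1]\<close> is the group ring of \<open>\<int>\<close>. The basis element \<open>:m:\<close> of the free
  module \<open>\<Y>\<^sub>t\<close> is \<open>Poly_Mapping.single m 1\<close>. The product of the algebra is not the
  convolution product that the library puts on the type.
\<close>

type_synonym lau = "int \<Rightarrow>\<^sub>0 int"

definition tpow :: "int \<Rightarrow> lau" where
  "tpow k = Poly_Mapping.single k 1"

type_synonym 'i yt = "'i mon \<Rightarrow>\<^sub>0 lau"

definition nord :: "'i mon \<Rightarrow> 'i yt" where
  "nord m = Poly_Mapping.single m 1"

definition scal :: "lau \<Rightarrow> 'i yt \<Rightarrow> 'i yt" where
  "scal c x = Poly_Mapping.map ((*) c) x"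

definition N_gen :: "int ^ 'i ^ 'i \<Rightarrow> ('i \<Rightarrow> nat) \<Rightarrow> 'i \<times> int \<Rightarrow> 'i \<times> int \<Rightarrow> int" where
  "N_gen C r = (\<lambda>(i, l) (j, k).
     zcoeff (zCartan_inv C r $ j $ i) (int (r j) + l - k)
     - zcoeff (zCartan_inv C r $ j $ i) (- int (r j) + l - k))"

definition bichar :: "int ^ 'i ^ 'i \<Rightarrow> ('i \<Rightarrow> nat) \<Rightarrow> 'i mon \<Rightarrow> 'i mon \<Rightarrow> int" where
  "bichar C r m1 m2 =
     (\<Sum>p\<in>Poly_Mapping.keys m1. \<Sum>q\<in>Poly_Mapping.keys m2.
        Poly_Mapping.lookup m1 p * Poly_Mapping.lookup m2 q * N_gen C r p q)"

definition yt_mult :: "int ^ 'i ^ 'i \<Rightarrow> ('i \<Rightarrow> nat) \<Rightarrow> 'i yt \<Rightarrow> 'i yt \<Rightarrow> 'i yt" where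
  "yt_mult C r x y =
     (\<Sum>m1\<in>Poly_Mapping.keys x. \<Sum>m2\<in>Poly_Mapping.keys y.
        scal (Poly_Mapping.lookup x m1 * Poly_Mapping.lookup y m2 * tpow (bichar C r m1 m2))
          (nord (m1 + m2)))"

definition yt_ring :: "int ^ 'i ^ 'i \<Rightarrow> ('i \<Rightarrow> nat) \<Rightarrow> 'i yt ring" where
  "yt_ring C r =
     \<lparr>carrier = UNIV, mult = yt_mult C r, one = nord 0, zero = 0, add = (+)\<rparr>"

definition ordered_prod :: "('a, 'b) monoid_scheme \<Rightarrow> 'a list \<Rightarrow> 'a" where
  "ordered_prod G xs = foldr (\<lambda>x y. x \<otimes>\<^bsub>G\<^esub> y) xs \<one>\<^bsub>G\<^esub>"


section \<open>The elements $E_{i,t}(m)$\<close>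

text \<open>
  For fixed \<open>l\<close> the \<open>Y\<^bsub>j,l\<^esub>\<close> commute in \<open>\<Y>\<^sub>t\<close>, so the order of the product
  over \<open>j \<noteq> i\<close> is immaterial; it is taken increasing. The inverse of \<open>:Y\<^bsub>j,l\<^esub>:\<close>
  is in general a power of \<open>t\<close> times \<open>:Y\<^bsub>j,l\<^esub>\<^sup>-\<^sup>1:\<close>, hence the negative powers are
  taken in the algebra. The exponent \<open>u\<^bsub>i,l\<^esub>(m)\<close> is nonnegative for \<open>m \<in> B\<^sub>i\<close>,
  so \<^const>\<open>nat\<close> does not truncate. The factors for the \<open>l\<close> not occurring in \<open>m\<close> are 1.
\<close>

definition E_factor ::
  "int ^ 'i::{finite,linorder} ^ 'i::{finite,linorder} \<Rightarrow> ('i \<Rightarrow> nat) \<Rightarrow> 'i \<Rightarrow> 'i mon \<Rightarrow> int \<Rightarrow> 'i yt" where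
  "E_factor C r i m l =
     (nord (Ymon i l) \<otimes>\<^bsub>yt_ring C r\<^esub>
        (nord 0 + scal (tpow 1) (nord (- Amon C r i (l + int (r i))))))
       [^]\<^bsub>yt_ring C r\<^esub> nat (Poly_Mapping.lookup m (i, l))
     \<otimes>\<^bsub>yt_ring C r\<^esub>
     ordered_prod (yt_ring C r)
       (map (\<lambda>j. nord (Ymon j l) [^]\<^bsub>yt_ring C r\<^esub> Poly_Mapping.lookup m (j, l))
         (sorted_list_of_set (UNIV - {i})))"

definition E_elt ::
  "int ^ 'i::{finite,linorder} ^ 'i::{finite,linorder} \<Rightarrow> ('i \<Rightarrow> nat) \<Rightarrow> 'i \<Rightarrow> 'i mon \<Rightarrow> 'i yt" where
  "E_elt C r i m =
     ordered_prod (yt_ring C r)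
       (map (E_factor C r i m) (sorted_list_of_set (snd ` Poly_Mapping.keys m)))"


section \<open>Completions\<close>

text \<open>
  Elements of \<open>\<Prod>\<^sub>m \<int>[t\<^sup>\<plusminus>\<^sup>1] :m:\<close> are functions from monomials to \<open>\<int>[t\<^sup>\<plusminus>\<^sup>1]\<close>, and
  infinite sums are taken coefficientwise. In the sums below only finitely many \<open>K\<close>
  contribute to a given monomial, because the \<open>A\<^bsub>j,l\<^esub>\<close> are multiplicatively independent.
\<close>

definition formal_sum :: "(nat \<Rightarrow> 'i yt) \<Rightarrow> 'i mon \<Rightarrow> lau" where
  "formal_sum x = (\<lambda>m. Sum_any (\<lambda>K. Poly_Mapping.lookup (x K) m))"

definition finite_sums :: "('i mon \<Rightarrow> ('i mon \<Rightarrow> lau) set) \<Rightarrow> ('i mon \<Rightarrow> lau) set" where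
  "finite_sums P =
     {f. \<exists>S g. finite S \<and> (\<forall>M\<in>S. g M \<in> P M) \<and> f = (\<lambda>m. \<Sum>M\<in>S. g M m)}"

definition YA :: "int ^ 'i ^ 'i \<Rightarrow> ('i \<Rightarrow> nat) \<Rightarrow> nat \<Rightarrow> 'i yt set" where
  "YA C r K = {x. Poly_Mapping.keys x \<subseteq> Ainv_products C r K}"

definition Yt_inf :: "int ^ 'i ^ 'i \<Rightarrow> ('i \<Rightarrow> nat) \<Rightarrow> ('i mon \<Rightarrow> lau) set" where
  "Yt_inf C r = finite_sums (\<lambda>M.
     {formal_sum (\<lambda>K. nord M \<otimes>\<^bsub>yt_ring C r\<^esub> x K) | x. \<forall>K. x K \<in> YA C r K})"

definition K_inf_single ::
  "int ^ 'i::{finite,linorder} ^ 'i::{finite,linorder} \<Rightarrow> ('i \<Rightarrow> nat) \<Rightarrow> 'i \<Rightarrow> ('i mon \<Rightarrow> lau) set" where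
  "K_inf_single C r i = finite_sums (\<lambda>M.
     {formal_sum (\<lambda>K. \<Sum>a\<in>F K. scal (c K a) (E_elt C r i (M + a))) | F c.
        \<forall>K. finite (F K) \<and> F K \<subseteq> {a \<in> Ainv_products C r K. M + a \<in> dominant {i}}})"

text \<open>For empty \<open>J\<close> the intersection is the whole of \<open>\<Y>\<^sub>t\<^sup>\<infinity>\<close>.\<close>

definition K_inf ::
  "int ^ 'i::{finite,linorder} ^ 'i::{finite,linorder} \<Rightarrow> ('i \<Rightarrow> nat) \<Rightarrow> 'i set \<Rightarrow> ('i mon \<Rightarrow> lau) set" where
  "K_inf C r J = {f \<in> Yt_inf C r. \<forall>i\<in>J. f \<in> K_inf_single C r i}"

definition monomials :: "('i mon \<Rightarrow> lau) \<Rightarrow> 'i mon set" where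
  "monomials f = {m. f m \<noteq> 0}"

end

theory Submission
  imports Defs
begin

text \<open>
  Invertibility of \<open>C\<close> gives real weights of the \<open>Y\<^bsub>j,l\<^esub>\<close>, independent of \<open>l\<close>, for which every
  \<open>A\<^bsub>i,l\<^esub>\<close> has degree 1. Then \<open>E\<^bsub>i,t\<^esub>(m)\<close> is a unit times \<open>:m:\<close> plus terms of
  strictly smaller degree, and the degrees of the monomials of an element of the completion lie in
  finitely many sequences decreasing by steps of 1, so a nonzero element \<open>f\<close> has a monomial
  \<open>m\<close> of maximal degree. For \<open>i \<in> J\<close> write \<open>f\<close> as a combination of the \<open>E\<^bsub>i,t\<^esub>(m')\<close>. An \<open>m'\<close> of
  maximal degree with nonzero coefficient is a monomial of \<open>f\<close>, since no other term can cancel its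
  leading term. Hence no \<open>m'\<close> that occurs has degree above that of \<open>m\<close>, so \<open>m\<close> can only come from
  \<open>E\<^bsub>i,t\<^esub>(m)\<close> itself, and \<open>m\<close> is \<open>i\<close>-dominant.
\<close>

unbundle no Formal_Power_Series.fps_syntax

section \<open>Weights making every A of degree one\<close>

text \<open>Positivity of the minor on \<open>{i, j}\<close> bounds the product of the two opposite
  entries by 3. This guarantees that the three products in \<open>Amon\<close> account for every
  nonzero off-diagonal entry.\<close>

lemma finite_type_Cartan_entries:
  fixes C :: "int ^ 'i::finite ^ 'i"
  assumes "finite_type_Cartan C" "i \<noteq> j"
  shows "C $ i $ j \<in> {0, -1, -2, -3}"
proof -
  define T where "T = Transposition.transpose i j"
  have ne: "id \<noteq> T"
    using assms(2) by (auto simp: T_def fun_eq_iff Transposition.transpose_def)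
  have "principal_minor C {i, j} = (\<Sum>p\<in>{id, T}. sign p * (\<Prod>k\<in>{i, j}. C $ k $ p k))"
    unfolding principal_minor_def
    by (rule sum.cong) (auto simp: permutes_doubleton_iff T_def)
  also have "\<dots> = C $ i $ i * C $ j $ j - C $ i $ j * C $ j $ i"
    using assms(2) ne by (simp add: T_def sign_swap_id)
  also have "\<dots> = 4 - C $ i $ j * C $ j $ i"
    using assms(1) by (simp add: finite_type_Cartan_def)
  finally have "principal_minor C {i, j} = 4 - C $ i $ j * C $ j $ i" .
  moreover have "principal_minor C {i, j} > 0"
    using assms(1) by (simp add: finite_type_Cartan_def)
  ultimately have "C $ i $ j * C $ j $ i < 4" by linarith
  moreover have le: "C $ i $ j \<le> 0" "C $ j $ i \<le> 0" and z: "C $ i $ j = 0 \<longleftrightarrow> C $ j $ i = 0"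
    using assms unfolding finite_type_Cartan_def by metis+
  \<comment> \<open>If \<open>C $ i $ j\<close> is nonzero, then \<open>- C $ j $ i\<close> is at
    least 1, so \<open>- C $ i $ j\<close> is at most the product of the two entries.\<close>
  ultimately have "- C $ i $ j < 4"
    using mult_left_mono[of 1 "- C $ j $ i" "- C $ i $ j"] by (cases "C $ i $ j = 0") auto
  with le show ?thesis by auto
qed

text \<open>The determinant of \<open>C\<close> is its full principal minor, hence nonzero, so the
  transposed system with all ones on the right is solvable over the reals. The solution need not be
  integral: in type A_1 it is 1/2.\<close>

lemma finite_type_Cartan_weights:
  fixes C :: "int ^ 'i::finite ^ 'i"
  assumes "finite_type_Cartan C"
  obtains w :: "'i \<Rightarrow> real" where "\<And>i. (\<Sum>j\<in>UNIV. of_int (C $ j $ i) * w j) = 1"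
proof -
  define A :: "real ^ 'i ^ 'i" where "A = (\<chi> i j. of_int (C $ j $ i))"
  \<comment> \<open>\<open>A\<close> is the real transpose of \<open>C\<close>; transposing back
    makes the Leibniz formula agree term by term with \<open>principal_minor\<close>.\<close>
  have "det (transpose A) = of_int (principal_minor C UNIV)"
    by (simp add: det_def principal_minor_def A_def transpose_def)
  moreover have "principal_minor C UNIV > 0"
    using assms by (simp add: finite_type_Cartan_def)
  ultimately have "det A \<noteq> 0" by simp
  then obtain A' where "A ** A' = mat 1"
    using invertible_det_nz[of A] by (auto simp: invertible_def)
  then have "A *v (A' *v 1) = 1"
    by (simp add: matrix_vector_mul_assoc)
  then obtain v where v: "A *v v = 1" by blast
  show ?thesis
  proof
    show "(\<Sum>j\<in>UNIV. of_int (C $ j $ i) * v $ j) = 1" for i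
    proof -
      have "(A *v v) $ i = 1" unfolding v by simp
      then show ?thesis
        by (simp add: matrix_vector_mult_def A_def)
    qed
  qed
qed

section \<open>The degree of a monomial, blind to the shift \<open>l\<close>\<close>

definition mon_deg :: "('i \<Rightarrow> real) \<Rightarrow> 'i mon \<Rightarrow> real" where
  "mon_deg w m = (\<Sum>p\<in>Poly_Mapping.keys m. of_int (Poly_Mapping.lookup m p) * w (fst p))"

lemma mon_deg_superset:
  assumes "finite S" "Poly_Mapping.keys m \<subseteq> S"
  shows "mon_deg w m = (\<Sum>p\<in>S. of_int (Poly_Mapping.lookup m p) * w (fst p))"
  unfolding mon_deg_def
  by (rule sum.mono_neutral_left) (use assms in \<open>auto simp: in_keys_iff\<close>)

lemma mon_deg_add: "mon_deg w (a + b) = mon_deg w a + mon_deg w b"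
proof -
  let ?S = "Poly_Mapping.keys a \<union> Poly_Mapping.keys b"
  show ?thesis
    using Poly_Mapping.keys_add[of a b]
    by (simp add: mon_deg_superset[of ?S] lookup_add sum.distrib algebra_simps)
qed

lemma mon_deg_zero [simp]: "mon_deg w 0 = 0"
  by (simp add: mon_deg_def)

lemma mon_deg_uminus: "mon_deg w (- a) = - mon_deg w a"
  using mon_deg_add[of w a "- a"] by simp

lemma mon_deg_diff: "mon_deg w (a - b) = mon_deg w a - mon_deg w b"
  using mon_deg_add[of w "a - b" b] by simp

lemma mon_deg_sum: "mon_deg w (\<Sum>x\<in>S. f x) = (\<Sum>x\<in>S. mon_deg w (f x))"
  by (induction S rule: infinite_finite_induct) (auto simp: mon_deg_add)

lemma mon_deg_Ymon [simp]: "mon_deg w (Ymon j l) = w j"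
  by (simp add: mon_deg_def Ymon_def)

text \<open>An entry \<open>- k\<close> in column \<open>i\<close> puts exactly \<open>k\<close>
  factors \<open>Ymon j _\<close> into the denominator of \<open>Amon C r i l\<close>, and their
  shifts do not affect the degree. The two factors in the numerator match the diagonal entry
  2.\<close>

lemma mon_deg_Amon:
  fixes C :: "int ^ 'i::finite ^ 'i"
  assumes "finite_type_Cartan C"
  shows "mon_deg w (Amon C r i l) = (\<Sum>j\<in>UNIV. of_int (C $ j $ i) * w j)"
proof -
  have filt: "(\<Sum>j | P j. g j) = (\<Sum>j\<in>UNIV. if P j then g j else 0)" for P and g :: "'i \<Rightarrow> real"
    by (simp add: sum.If_cases)
  have "(\<Sum>j\<in>UNIV. of_int (C $ j $ i) * w j)
      = (\<Sum>j\<in>UNIV. (if j = i then 2 * w j else 0)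
          - (if C $ j $ i = - 1 then w j else 0)
          - (if C $ j $ i = - 2 then 2 * w j else 0)
          - (if C $ j $ i = - 3 then 3 * w j else 0))"
  proof (rule sum.cong)
    fix j
    show "of_int (C $ j $ i) * w j = (if j = i then 2 * w j else 0)
          - (if C $ j $ i = - 1 then w j else 0)
          - (if C $ j $ i = - 2 then 2 * w j else 0)
          - (if C $ j $ i = - 3 then 3 * w j else 0)"
    proof (cases "j = i")
      case True
      with assms show ?thesis by (simp add: finite_type_Cartan_def)
    next
      case False
      with finite_type_Cartan_entries[OF assms this] show ?thesis by auto
    qed
  qed simp
  then show ?thesis
    by (simp add: Amon_def mon_deg_add mon_deg_diff mon_deg_sum filt sum_subtractf)
qed

section \<open>Leading terms\<close>

lemma tpow_add: "tpow a * tpow b = tpow (a + b)"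
  by (simp add: tpow_def mult_single)

lemma tpow_0 [simp]: "tpow 0 = 1"
  by (simp add: tpow_def)

text \<open>The factor cancels against its inverse \<open>tpow (- k)\<close>.\<close>

lemma mult_tpow_eq_0_iff [simp]: "a * tpow k = 0 \<longleftrightarrow> a = 0"
proof
  assume "a * tpow k = 0"
  then have "a * tpow k * tpow (- k) = 0" by simp
  then show "a = 0" by (simp add: mult.assoc tpow_add)
qed simp

lemma tpow_nonzero [simp]: "tpow k \<noteq> 0"
  using mult_tpow_eq_0_iff[of 1 k] by simp

lemma lookup_scal: "Poly_Mapping.lookup (scal c x) m = c * Poly_Mapping.lookup x m"
  by (simp add: scal_def Poly_Mapping.map.rep_eq when_def)

lemma scal_nord: "scal c (nord m) = Poly_Mapping.single m c"
  by (rule poly_mapping_eqI) (simp add: lookup_scal nord_def lookup_single when_def)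

lemma lookup_nord: "Poly_Mapping.lookup (nord m) m' = (if m' = m then 1 else 0)"
  by (simp add: nord_def lookup_single when_def)

lemma yt_mult_eq:
  "yt_mult C r x y =
     (\<Sum>m1\<in>Poly_Mapping.keys x. \<Sum>m2\<in>Poly_Mapping.keys y.
        Poly_Mapping.single (m1 + m2)
          (Poly_Mapping.lookup x m1 * Poly_Mapping.lookup y m2 * tpow (bichar C r m1 m2)))"
  by (simp add: yt_mult_def scal_nord)

lemma lookup_yt_mult:
  "Poly_Mapping.lookup (yt_mult C r x y) m =
     (\<Sum>m1\<in>Poly_Mapping.keys x. \<Sum>m2\<in>Poly_Mapping.keys y.
        if m1 + m2 = m
        then Poly_Mapping.lookup x m1 * Poly_Mapping.lookup y m2 * tpow (bichar C r m1 m2) else 0)"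
  by (simp add: yt_mult_eq lookup_sum lookup_single when_def)

lemma keys_yt_mult:
  assumes "m \<in> Poly_Mapping.keys (yt_mult C r x y)"
  obtains m1 m2 where "m1 \<in> Poly_Mapping.keys x" "m2 \<in> Poly_Mapping.keys y" "m = m1 + m2"
proof -
  have "\<exists>m1\<in>Poly_Mapping.keys x. \<exists>m2\<in>Poly_Mapping.keys y. m = m1 + m2"
  proof (rule ccontr)
    assume "\<not> ?thesis"
    then have "Poly_Mapping.lookup (yt_mult C r x y) m = 0"
      unfolding lookup_yt_mult by (intro sum.neutral ballI) auto
    with assms show False by (simp add: in_keys_iff)
  qed
  with that show ?thesis by blast
qed

lemma lookup_single_yt_mult:
  "Poly_Mapping.lookup (yt_mult C r (Poly_Mapping.single m c) y) (m + m')
     = c * Poly_Mapping.lookup y m' * tpow (bichar C r m m')"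
proof -
  have "(\<Sum>m2\<in>Poly_Mapping.keys y.
          if m2 = m' then c * Poly_Mapping.lookup y m2 * tpow (bichar C r m m2) else 0)
      = c * Poly_Mapping.lookup y m' * tpow (bichar C r m m')"
    by (simp add: in_keys_iff)
  \<comment> \<open>The keys of \<open>single m c\<close> form \<open>{m}\<close>, or the empty set
    when \<open>c = 0\<close>; summing over \<open>{m}\<close> treats both cases.\<close>
  moreover have "Poly_Mapping.lookup (yt_mult C r (Poly_Mapping.single m c) y) (m + m')
      = (\<Sum>m1\<in>{m}. \<Sum>m2\<in>Poly_Mapping.keys y.
        if m1 + m2 = m + m'
        then Poly_Mapping.lookup (Poly_Mapping.single m c) m1 * Poly_Mapping.lookup y m2
          * tpow (bichar C r m1 m2) else 0)"
    unfolding lookup_yt_mult by (rule sum.mono_neutral_left) (auto simp: in_keys_iff lookup_single when_def split: if_splits)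
  ultimately show ?thesis by (auto simp: in_keys_iff)
qed

lemma yt_mult_single:
  "yt_mult C r (Poly_Mapping.single m a) (Poly_Mapping.single m' b)
     = Poly_Mapping.single (m + m') (a * b * tpow (bichar C r m m'))"
  by (cases "a = 0"; cases "b = 0") (simp_all add: yt_mult_eq)

text \<open>Both sides equal \<open>- bichar C r m m\<close>. Hence one power of t corrects the left
  and the right inverse of a monomial alike.\<close>

lemma bichar_uminus: "bichar C r (- m) m = bichar C r m (- m)"
  by (simp add: bichar_def)

section \<open>Powers and inverses of single terms\<close>

lemma yt_ring_sel [simp]:
  "x \<otimes>\<^bsub>yt_ring C r\<^esub> y = yt_mult C r x y" "\<one>\<^bsub>yt_ring C r\<^esub> = nord 0" "carrier (yt_ring C r) = UNIV"
  by (simp_all add: yt_ring_def)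

text \<open>The exponent of t is left existential: later it matters only that the coefficient is a
  unit.\<close>

lemma nord_nat_pow:
  "\<exists>k. nord (Ymon j l) [^]\<^bsub>yt_ring C r\<^esub> (n::nat)
     = Poly_Mapping.single (Poly_Mapping.single (j, l) (int n)) (tpow k)"
proof (induction n)
  case 0
  show ?case by (rule exI[of _ 0]) (simp add: nord_def)
next
  case (Suc n)
  then obtain k where "nord (Ymon j l) [^]\<^bsub>yt_ring C r\<^esub> n
      = Poly_Mapping.single (Poly_Mapping.single (j, l) (int n)) (tpow k)" ..
  then have "nord (Ymon j l) [^]\<^bsub>yt_ring C r\<^esub> Suc n
      = Poly_Mapping.single (Poly_Mapping.single (j, l) (int (Suc n)))
          (tpow (k + bichar C r (Poly_Mapping.single (j, l) (int n)) (Ymon j l)))"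
    by (simp add: nord_def Ymon_def yt_mult_single tpow_add add.commute flip: single_add)
  then show ?case ..
qed

text \<open>Multiplication by a monomial shifts the coefficients, so the inverse is unique
  without appeal to associativity.\<close>

lemma inv_single:
  "\<exists>k'. inv\<^bsub>yt_ring C r\<^esub> (Poly_Mapping.single m (tpow k)) = Poly_Mapping.single (- m) (tpow k')"
proof -
  let ?x = "Poly_Mapping.single m (tpow k)"
  \<comment> \<open>This exponent solves \<open>k + k' + bichar C r m (- m) = 0\<close>.\<close>
  define k' where "k' = - k - bichar C r m (- m)"
  let ?y = "Poly_Mapping.single (- m) (tpow k')"
  have inv: "yt_mult C r ?x ?y = nord 0" "yt_mult C r ?y ?x = nord 0"
    by (simp_all add: yt_mult_single tpow_add bichar_uminus k'_def nord_def)
  have uniq: "y = ?y" if y: "yt_mult C r ?x y = nord 0" for y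
  proof (rule poly_mapping_eqI)
    fix m'
    \<comment> \<open>Both sides are the coefficient of \<open>nord 0\<close> at
      \<open>m + m'\<close>.\<close>
    have "tpow k * Poly_Mapping.lookup y m' * tpow (bichar C r m m')
        = tpow k * Poly_Mapping.lookup ?y m' * tpow (bichar C r m m')"
      using y inv(1) by (metis lookup_single_yt_mult)
    then have "(Poly_Mapping.lookup y m' - Poly_Mapping.lookup ?y m')
        * tpow (k + bichar C r m m') = 0"
      by (simp add: algebra_simps flip: tpow_add)
    then show "Poly_Mapping.lookup y m' = Poly_Mapping.lookup ?y m'"
      by (simp only: mult_tpow_eq_0_iff right_minus_eq)
  qed
  have "inv\<^bsub>yt_ring C r\<^esub> ?x = ?y"
    unfolding m_inv_def yt_ring_sel
  proof (rule the_equality)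
    show "?y \<in> UNIV \<and> yt_mult C r ?x ?y = nord 0 \<and> yt_mult C r ?y ?x = nord 0"
      using inv by blast
  qed (use uniq in blast)
  then show ?thesis by blast
qed

section \<open>Elements whose unique top-degree term has a power of t as coefficient\<close>

definition leading :: "('i mon \<Rightarrow> real) \<Rightarrow> 'i mon \<Rightarrow> 'i yt \<Rightarrow> bool" where
  "leading d m x \<longleftrightarrow> (\<exists>k. Poly_Mapping.lookup x m = tpow k) \<and>
     (\<forall>m'\<in>Poly_Mapping.keys x. m' \<noteq> m \<longrightarrow> d m' < d m)"

lemma leading_keys:
  assumes "leading d m x" "Poly_Mapping.lookup x m' \<noteq> 0"
  shows "m' = m \<or> d m' < d m"
  using assms by (auto simp: leading_def in_keys_iff)

lemma leading_single: "leading d m (Poly_Mapping.single m (tpow k))"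
  by (auto simp: leading_def)

lemma leading_one: "leading d 0 (nord 0)"
  unfolding nord_def using leading_single[of d 0 0] by simp

text \<open>By additivity of \<open>d\<close>, any pair of monomials other than the two leading ones
  has a strictly smaller total degree. The top coefficient is therefore a single product of powers
  of t, again a unit.\<close>

lemma leading_mult:
  assumes d: "\<And>a b. d (a + b) = d a + d b"
    and x: "leading d m x" and y: "leading d m' y"
  shows "leading d (m + m') (yt_mult C r x y)"
proof -
  from x y obtain k k' where k: "Poly_Mapping.lookup x m = tpow k" "Poly_Mapping.lookup y m' = tpow k'"
    by (auto simp: leading_def)
  have mem: "m \<in> Poly_Mapping.keys x" "m' \<in> Poly_Mapping.keys y"
    using k by (auto simp: in_keys_iff)
  have le: "d m1 + d m2 < d m + d m'"
    if "m1 \<in> Poly_Mapping.keys x" "m2 \<in> Poly_Mapping.keys y" "m1 \<noteq> m \<or> m2 \<noteq> m'" for m1 m2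
  proof -
    have "m1 = m \<or> d m1 < d m" "m2 = m' \<or> d m2 < d m'"
      using that leading_keys[OF x] leading_keys[OF y] by (auto simp: in_keys_iff)
    with that show ?thesis by auto
  qed
  \<comment> \<open>Equal monomials have equal degree, which the strict inequality \<open>le\<close>
    allows only for the leading pair.\<close>
  have *: "m1 + m2 = m + m' \<longleftrightarrow> m1 = m \<and> m2 = m'"
    if "m1 \<in> Poly_Mapping.keys x" "m2 \<in> Poly_Mapping.keys y" for m1 m2
    using le[OF that] d by (metis less_irrefl)
  have "Poly_Mapping.lookup (yt_mult C r x y) (m + m')
     = (\<Sum>m1\<in>Poly_Mapping.keys x. \<Sum>m2\<in>Poly_Mapping.keys y.
         if m2 = m' then if m1 = m
         then Poly_Mapping.lookup x m1 * Poly_Mapping.lookup y m2 * tpow (bichar C r m1 m2)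
         else 0 else 0)"
    unfolding lookup_yt_mult by (intro sum.cong refl) (simp add: *)
  also have "\<dots> = tpow (k + k' + bichar C r m m')"
    using mem by (simp add: k tpow_add)
  finally show ?thesis
    unfolding leading_def
    by (metis d keys_yt_mult le)
qed

lemma leading_nat_pow:
  assumes d: "\<And>a b. d (a + b) = d a + d b" and x: "leading d (Poly_Mapping.single p 1) x"
  shows "leading d (Poly_Mapping.single p (int n)) (x [^]\<^bsub>yt_ring C r\<^esub> n)"
proof (induction n)
  case 0
  show ?case by (simp add: leading_one)
next
  case (Suc n)
  from leading_mult[of d, OF d this x, of C r] show ?case
    by (simp add: add.commute flip: single_add)
qed

text \<open>A negative power is the inverse of a natural power, and both operations keep an element
  a single term with a unit coefficient.\<close>

lemma leading_int_pow_Ymon: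
  "leading d (Poly_Mapping.single (j, l) n) (nord (Ymon j l) [^]\<^bsub>yt_ring C r\<^esub> (n::int))"
proof (cases "n < 0")
  case True
  obtain k where k: "nord (Ymon j l) [^]\<^bsub>yt_ring C r\<^esub> nat (- n)
      = Poly_Mapping.single (Poly_Mapping.single (j, l) (- n)) (tpow k)"
    using nord_nat_pow[where j = j and l = l and C = C and r = r and n = "nat (- n)"] True
    by (metis int_nat_eq neg_0_le_iff_le order_less_imp_le)
  obtain k' where "nord (Ymon j l) [^]\<^bsub>yt_ring C r\<^esub> n
      = Poly_Mapping.single (Poly_Mapping.single (j, l) n) (tpow k')"
    using inv_single[of C r "Poly_Mapping.single (j, l) (- n)" k] True k
    by (metis int_pow_def2 single_uminus minus_minus)
  then show ?thesis by (simp add: leading_single)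
next
  case False
  then obtain k where "nord (Ymon j l) [^]\<^bsub>yt_ring C r\<^esub> n
      = Poly_Mapping.single (Poly_Mapping.single (j, l) n) (tpow k)"
    using nord_nat_pow[where j = j and l = l and C = C and r = r and n = "nat n"]
    by (metis int_nat_eq int_pow_def2 not_less)
  then show ?thesis by (simp add: leading_single)
qed

lemma leading_ordered_prod:
  assumes d: "\<And>a b. d (a + b) = d a + d b"
    and "\<And>x. x \<in> set xs \<Longrightarrow> leading d (\<mu> x) (g x)"
  shows "leading d (\<Sum>x\<leftarrow>xs. \<mu> x) (ordered_prod (yt_ring C r) (map g xs))"
  using assms(2)
proof (induction xs)
  case Nil
  show ?case by (simp add: ordered_prod_def leading_one)
next
  case (Cons x xs)
  then have "leading d (\<mu> x) (g x)"
    and "leading d (\<Sum>x\<leftarrow>xs. \<mu> x) (ordered_prod (yt_ring C r) (map g xs))"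
    by simp_all
  from leading_mult[of d, OF d this, of C r] show ?case
    by (simp add: ordered_prod_def)
qed

text \<open>Since the inverse of A has negative degree, \<open>1 + t A^{-1}\<close> has leading
  monomial 1, so the first factor has the same leading monomial as the corresponding power of
  \<open>Ymon i l\<close>.\<close>

lemma leading_E_factor:
  assumes d: "\<And>a b. d (a + b) = d a + d b"
    and A: "d (- Amon C r i (l + int (r i))) < 0"
    and m: "Poly_Mapping.lookup m (i, l) \<ge> 0"
  shows "leading d (\<Sum>j\<in>UNIV. Poly_Mapping.single (j, l) (Poly_Mapping.lookup m (j, l)))
           (E_factor C r i m l)"
proof -
  have d0: "d 0 = 0" using d[of 0 0] by simp
  \<comment> \<open>The monomial \<open>- Amon C r i (l + int (r i))\<close> differs from 0 because
    its degree is negative, so the coefficient at 0 is exactly 1.\<close>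
  have "leading d 0 (nord 0 + scal (tpow 1) (nord (- Amon C r i (l + int (r i)))))"
    using A d0 unfolding leading_def
    by (auto simp: lookup_scal lookup_add in_keys_iff lookup_nord
        intro!: exI[of _ 0] split: if_splits)
  then have "leading d (Ymon i l + 0) (yt_mult C r (nord (Ymon i l))
      (nord 0 + scal (tpow 1) (nord (- Amon C r i (l + int (r i))))))"
    using leading_single[of d "Ymon i l" 0] by (intro leading_mult[of d, OF d]) (auto simp: nord_def)
  then have 1: "leading d (Poly_Mapping.single (i, l) (Poly_Mapping.lookup m (i, l)))
      (yt_mult C r (nord (Ymon i l))
        (nord 0 + scal (tpow 1) (nord (- Amon C r i (l + int (r i)))))
        [^]\<^bsub>yt_ring C r\<^esub> nat (Poly_Mapping.lookup m (i, l)))"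
    using leading_nat_pow[of d, OF d, of "(i, l)" _ "nat (Poly_Mapping.lookup m (i, l))"] m
    by (simp add: Ymon_def)
  have 2: "leading d (\<Sum>j\<leftarrow>sorted_list_of_set (UNIV - {i}).
        Poly_Mapping.single (j, l) (Poly_Mapping.lookup m (j, l)))
      (ordered_prod (yt_ring C r)
         (map (\<lambda>j. nord (Ymon j l) [^]\<^bsub>yt_ring C r\<^esub> Poly_Mapping.lookup m (j, l))
           (sorted_list_of_set (UNIV - {i}))))"
    by (intro leading_ordered_prod[of d, OF d] leading_int_pow_Ymon)
  from leading_mult[of d, OF d 1 2, of C r] show ?thesis
    by (simp add: E_factor_def sum_list_distinct_conv_sum_set sum.remove[of UNIV i])
qed

lemma leading_E_elt:
  assumes d: "\<And>a b. d (a + b) = d a + d b"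
    and A: "\<And>l. d (- Amon C r i l) < 0"
    and m: "m \<in> dominant {i}"
  shows "leading d m (E_elt C r i m)"
proof -
  let ?\<mu> = "\<lambda>l. \<Sum>j\<in>UNIV. Poly_Mapping.single (j, l) (Poly_Mapping.lookup m (j, l))"
  \<comment> \<open>Groups the exponents of \<open>m\<close> by their second index; an
    \<open>l\<close> outside the index set carries no exponent.\<close>
  have "m = sum ?\<mu> (snd ` Poly_Mapping.keys m)"
  proof (rule poly_mapping_eqI)
    fix p :: "'a \<times> int"
    obtain j l where p: "p = (j, l)" by force
    have "Poly_Mapping.lookup (?\<mu> l') p
        = (if l' = l then Poly_Mapping.lookup m p else 0)" for l'
      by (simp add: p lookup_sum lookup_single when_def)
    then have "Poly_Mapping.lookup (sum ?\<mu> (snd ` Poly_Mapping.keys m)) p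
        = (if l \<in> snd ` Poly_Mapping.keys m then Poly_Mapping.lookup m p else 0)"
      by (simp add: lookup_sum)
    also have "\<dots> = Poly_Mapping.lookup m p"
      using p by (force simp: in_keys_iff image_iff)
    finally show "Poly_Mapping.lookup m p
        = Poly_Mapping.lookup (sum ?\<mu> (snd ` Poly_Mapping.keys m)) p" ..
  qed
  moreover have "leading d (\<Sum>l\<leftarrow>sorted_list_of_set (snd ` Poly_Mapping.keys m). ?\<mu> l)
      (E_elt C r i m)"
    unfolding E_elt_def
    using m by (intro leading_ordered_prod[of d, OF d] leading_E_factor[of d, OF d] A) (auto simp: dominant_def)
  ultimately show ?thesis
    by (simp add: sum_list_distinct_conv_sum_set)
qed

section \<open>Monomials of maximal degree\<close>

text \<open>Above the level of \<open>x\<^sub>0\<close> only finitely many \<open>K\<close> are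
  possible for each \<open>M\<close>, so only finitely many degrees occur there and their maximum is
  attained.\<close>

lemma ex_max_degree:
  fixes d :: "'a \<Rightarrow> real"
  assumes "finite S" "P x\<^sub>0" and "\<And>x. P x \<Longrightarrow> \<exists>M\<in>S. \<exists>K::nat. d x = e M - real K"
  obtains x where "P x" "\<And>y. P y \<Longrightarrow> d y \<le> d x"
proof -
  define V where "V = d ` {x. P x \<and> d x \<ge> d x\<^sub>0}"
  have "V \<subseteq> (\<Union>M\<in>S. (\<lambda>K. e M - real K) ` {..nat \<lfloor>e M - d x\<^sub>0\<rfloor>})"
  proof
    fix v assume "v \<in> V"
    then obtain M and K :: nat where "M \<in> S" "v = e M - real K" "v \<ge> d x\<^sub>0"
      using assms(3) unfolding V_def by blast
    then show "v \<in> (\<Union>M\<in>S. (\<lambda>K. e M - real K) ` {..nat \<lfloor>e M - d x\<^sub>0\<rfloor>})"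
      by (force simp: le_nat_floor)
  qed
  then have fin: "finite V" using assms(1) finite_subset by blast
  have "V \<noteq> {}" using assms(2) by (auto simp: V_def)
  then obtain x where x: "P x" "d x = Max V"
    using Max_in[OF fin] unfolding V_def by auto
  have "d y \<le> d x" if "P y" for y
  proof (cases "d y \<ge> d x\<^sub>0")
    case True
    with that have "d y \<in> V" by (simp add: V_def)
    then show ?thesis using Max_ge[OF fin] x(2) by simp
  next
    case False
    have "d x\<^sub>0 \<in> V" using assms(2) by (simp add: V_def)
    then show ?thesis using Max_ge[OF fin] x(2) False by fastforce
  qed
  with x that show ?thesis by blast
qed

section \<open>Degrees of monomials in the completions\<close>

lemma mon_deg_Ainv_products:
  assumes "\<And>j l. mon_deg w (Amon C r j l) = 1" "a \<in> Ainv_products C r K"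
  shows "mon_deg w a = - real K"
proof -
  have "mon_deg w (\<Sum>(j, l)\<leftarrow>s. - Amon C r j l) = - real (length s)" for s
    by (induction s) (auto simp: mon_deg_add mon_deg_diff mon_deg_uminus assms(1))
  with assms(2) show ?thesis by (auto simp: Ainv_products_def)
qed

lemma Yt_inf_degrees:
  assumes deg: "\<And>j l. mon_deg w (Amon C r j l) = 1" and "f \<in> Yt_inf C r"
  obtains S where "finite S"
    and "\<And>m. f m \<noteq> 0 \<Longrightarrow> \<exists>M\<in>S. \<exists>K::nat. mon_deg w m = mon_deg w M - real K"
proof -
  from assms(2) obtain S g where S: "finite S" and f: "f = (\<lambda>m. \<Sum>M\<in>S. g M m)"
    and g: "\<forall>M\<in>S. \<exists>x. g M = formal_sum (\<lambda>K. yt_mult C r (nord M) (x K)) \<and> (\<forall>K. x K \<in> YA C r K)"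
    by (auto simp: Yt_inf_def finite_sums_def)
  have "\<exists>M\<in>S. \<exists>K::nat. mon_deg w m = mon_deg w M - real K" if "f m \<noteq> 0" for m
  proof -
    from that f obtain M where M: "M \<in> S" "g M m \<noteq> 0"
      by (meson sum.neutral)
    with g obtain x where x: "g M = formal_sum (\<lambda>K. yt_mult C r (nord M) (x K))"
      "\<forall>K. x K \<in> YA C r K" by blast
    \<comment> \<open>\<open>Sum_any\<close> takes the value 0 on infinite support, so a nonzero
      value always exhibits a nonzero term.\<close>
    from M(2) obtain K where "Poly_Mapping.lookup (yt_mult C r (nord M) (x K)) m \<noteq> 0"
      unfolding x(1) formal_sum_def by (rule Sum_any.not_neutral_obtains_not_neutral)
    then have "m \<in> Poly_Mapping.keys (yt_mult C r (nord M) (x K))"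
      by (simp add: in_keys_iff)
    then obtain a where "m = M + a" "a \<in> Poly_Mapping.keys (x K)"
      by (rule keys_yt_mult) (auto simp: nord_def)
    moreover then have "a \<in> Ainv_products C r K" using x(2) by (auto simp: YA_def)
    ultimately show ?thesis
      using mon_deg_Ainv_products[OF deg] M(1) by (auto simp: mon_deg_add)
  qed
  with S that show ?thesis by blast
qed

text \<open>Restricting to degrees at least \<open>\<delta>\<close> turns the infinite sums into one finite sum.\<close>

lemma K_inf_single_truncation:
  fixes \<delta> :: real
  assumes deg: "\<And>j l. mon_deg w (Amon C r j l) = 1" and "f \<in> K_inf_single C r i"
  obtains U \<Lambda> where "finite U" "U \<subseteq> dominant {i}"
    and "\<And>m. mon_deg w m \<ge> \<delta> \<Longrightarrow> f m = (\<Sum>\<mu>\<in>U. \<Lambda> \<mu> * Poly_Mapping.lookup (E_elt C r i \<mu>) m)"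
proof -
  have lead: "leading (mon_deg w) m (E_elt C r i m)" if "m \<in> dominant {i}" for m
    using that by (intro leading_E_elt) (auto simp: mon_deg_add mon_deg_uminus deg)
  from assms(2) obtain S g where S: "finite S" and f: "f = (\<lambda>m. \<Sum>M\<in>S. g M m)"
    and ex: "\<forall>M\<in>S. \<exists>F c. g M = formal_sum (\<lambda>K. \<Sum>a\<in>F K. scal (c K a) (E_elt C r i (M + a))) \<and>
      (\<forall>K. finite (F K) \<and> F K \<subseteq> {a \<in> Ainv_products C r K. M + a \<in> dominant {i}})"
    unfolding K_inf_single_def finite_sums_def by blast
  \<comment> \<open>Packs \<open>F\<close> and \<open>c\<close> into one pair, so that both are
    chosen together for each \<open>M\<close>.\<close>
  define Q where "Q M p \<longleftrightarrow>
      g M = formal_sum (\<lambda>K. \<Sum>a\<in>fst p K. scal (snd p K a) (E_elt C r i (M + a))) \<and>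
      (\<forall>K. finite (fst p K) \<and> fst p K \<subseteq> {a \<in> Ainv_products C r K. M + a \<in> dominant {i}})"
    for M p
  have "\<exists>p. Q M p" if "M \<in> S" for M
  proof -
    from bspec[OF ex that] obtain F c where "Q M (F, c)"
      unfolding Q_def fst_conv snd_conv by blast
    then show ?thesis ..
  qed
  then obtain p where p: "\<And>M. M \<in> S \<Longrightarrow> Q M (p M)" by metis
  define F where "F M = fst (p M)" for M
  define c where "c M = snd (p M)" for M
  have g: "g M = formal_sum (\<lambda>K. \<Sum>a\<in>F M K. scal (c M K a) (E_elt C r i (M + a)))"
    and fin: "finite (F M K)" and F: "F M K \<subseteq> {a \<in> Ainv_products C r K. M + a \<in> dominant {i}}"
    if "M \<in> S" for M K
    using p[OF that] by (simp_all add: Q_def F_def c_def)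
  \<comment> \<open>For \<open>K\<close> above this bound, \<open>M + a\<close> has degree below
    \<open>\<delta>\<close>, and so does everything in \<open>E_elt C r i (M + a)\<close>.\<close>
  define N where "N M = nat \<lfloor>mon_deg w M - \<delta>\<rfloor>" for M
  define T where "T = (SIGMA M:S. SIGMA K:{..N M}. F M K)"
  have finT: "finite T" using S fin by (auto simp: T_def)
  define \<pi> where "\<pi> = (\<lambda>(M, K::nat, a). M + a :: 'a mon)"
  define b where "b = (\<lambda>(M, K, a). c M K a)"
  have fm: "f m = (\<Sum>\<tau>\<in>T. b \<tau> * Poly_Mapping.lookup (E_elt C r i (\<pi> \<tau>)) m)"
    if m: "mon_deg w m \<ge> \<delta>" for m
  proof -
    have "g M m = (\<Sum>K\<le>N M. \<Sum>a\<in>F M K. c M K a * Poly_Mapping.lookup (E_elt C r i (M + a)) m)"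
      if M: "M \<in> S" for M
    proof -
      have "Poly_Mapping.lookup (E_elt C r i (M + a)) m = 0" if "\<not> K \<le> N M" "a \<in> F M K" for K a
      proof (rule ccontr)
        assume nz: "Poly_Mapping.lookup (E_elt C r i (M + a)) m \<noteq> 0"
        have a: "a \<in> Ainv_products C r K" "M + a \<in> dominant {i}" using F[OF M] that by auto
        have "mon_deg w m \<le> mon_deg w (M + a)"
          using leading_keys[OF lead[OF a(2)] nz] by auto
        then have "real K \<le> mon_deg w M - \<delta>"
          using m mon_deg_Ainv_products[OF deg a(1)] by (simp add: mon_deg_add)
        then have "K \<le> N M" unfolding N_def by (rule le_nat_floor)
        with that show False by simp
      qed
      then have z: "(\<Sum>a\<in>F M K. c M K a * Poly_Mapping.lookup (E_elt C r i (M + a)) m) = 0"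
        if "\<not> K \<le> N M" for K
        using that by (intro sum.neutral ballI) simp
      have "g M m
          = Sum_any (\<lambda>K. \<Sum>a\<in>F M K. c M K a * Poly_Mapping.lookup (E_elt C r i (M + a)) m)"
        by (simp add: g[OF M] formal_sum_def lookup_sum lookup_scal)
      \<comment> \<open>The nonzero terms lie in a finite set, so \<open>Sum_any\<close> is the
        actual sum and not its default 0.\<close>
      also have "\<dots> = (\<Sum>K\<le>N M. \<Sum>a\<in>F M K. c M K a * Poly_Mapping.lookup (E_elt C r i (M + a)) m)"
        by (rule Sum_any.expand_superset) (use z in auto)
      finally show ?thesis .
    qed
    then show ?thesis
      using S fin by (simp add: f T_def \<pi>_def b_def sum.Sigma case_prod_unfold)
  qed
  \<comment> \<open>Different triples may give the same monomial. Collecting their coefficients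
    makes the leading monomials in the sum pairwise distinct.\<close>
  define \<Lambda> where "\<Lambda> \<mu> = (\<Sum>\<tau> | \<tau> \<in> T \<and> \<pi> \<tau> = \<mu>. b \<tau>)" for \<mu>
  show ?thesis
  proof
    show "finite (\<pi> ` T)" using finT by simp
    show "\<pi> ` T \<subseteq> dominant {i}" using F by (auto simp: T_def \<pi>_def)
    show "f m = (\<Sum>\<mu>\<in>\<pi> ` T. \<Lambda> \<mu> * Poly_Mapping.lookup (E_elt C r i \<mu>) m)"
      if "mon_deg w m \<ge> \<delta>" for m
    proof -
      have "f m = (\<Sum>\<mu>\<in>\<pi> ` T. \<Sum>\<tau> | \<tau> \<in> T \<and> \<pi> \<tau> = \<mu>.
          b \<tau> * Poly_Mapping.lookup (E_elt C r i (\<pi> \<tau>)) m)"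
        unfolding fm[OF that] by (rule sum.image_gen[OF finT])
      also have "\<dots> = (\<Sum>\<mu>\<in>\<pi> ` T. \<Lambda> \<mu> * Poly_Mapping.lookup (E_elt C r i \<mu>) m)"
        by (simp add: \<Lambda>_def sum_distrib_right)
      finally show ?thesis .
    qed
  qed
qed

lemma max_degree_dominant:
  assumes deg: "\<And>j l. mon_deg w (Amon C r j l) = 1" and f: "f \<in> K_inf_single C r i"
    and m: "f m \<noteq> 0" and max: "\<And>m'. f m' \<noteq> 0 \<Longrightarrow> mon_deg w m' \<le> mon_deg w m"
  shows "m \<in> dominant {i}"
proof -
  let ?d = "mon_deg w" and ?E = "\<lambda>\<mu>. Poly_Mapping.lookup (E_elt C r i \<mu>)"
  \<comment> \<open>Truncation at the degree of \<open>m\<close> suffices: the formula is evaluated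
    at \<open>m\<close> and at \<open>\<nu>\<close> below, whose degree is at least that of
    \<open>m\<close>.\<close>
  obtain U \<Lambda> where U: "finite U" "U \<subseteq> dominant {i}"
    and fs: "\<And>m'. ?d m' \<ge> ?d m \<Longrightarrow> f m' = (\<Sum>\<mu>\<in>U. \<Lambda> \<mu> * ?E \<mu> m')"
    using K_inf_single_truncation[OF deg f, of "?d m"] by blast
  have lead: "leading ?d \<mu> (E_elt C r i \<mu>)" if "\<mu> \<in> U" for \<mu>
    using that U(2) by (intro leading_E_elt) (auto simp: mon_deg_add mon_deg_uminus deg)
  from m fs[of m] have "(\<Sum>\<mu>\<in>U. \<Lambda> \<mu> * ?E \<mu> m) \<noteq> 0" by simp
  then obtain \<mu> where \<mu>: "\<mu> \<in> U" "\<Lambda> \<mu> * ?E \<mu> m \<noteq> 0"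
    by (rule sum.not_neutral_contains_not_neutral)
  then have \<mu>': "\<Lambda> \<mu> \<noteq> 0" "?E \<mu> m \<noteq> 0" by auto
  define W where "W = {\<mu> \<in> U. \<Lambda> \<mu> \<noteq> 0}"
  have "finite W" "\<mu> \<in> W" using U \<mu> \<mu>' by (auto simp: W_def)
  then have "Max (?d ` W) \<in> ?d ` W" by (intro Max_in) auto
  then obtain \<nu> where "\<nu> \<in> W" "?d \<nu> = Max (?d ` W)" by auto
  with \<open>finite W\<close> have \<nu>: "\<nu> \<in> W" "\<And>\<mu>. \<mu> \<in> W \<Longrightarrow> ?d \<mu> \<le> ?d \<nu>"
    by simp_all
  have le: "?d m \<le> ?d \<mu>" "?d \<mu> \<le> ?d \<nu>"
    using leading_keys[OF lead[OF \<mu>(1)] \<mu>'(2)] \<nu>(2)[OF \<open>\<mu> \<in> W\<close>] by auto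
  \<comment> \<open>If \<open>\<nu>\<close> occurred in \<open>E_elt C r i \<kappa>\<close> for
    another \<open>\<kappa>\<close>, then \<open>\<kappa>\<close> would have larger degree than
    \<open>\<nu>\<close>, which maximality allows only when its coefficient vanishes.\<close>
  have "\<Lambda> \<kappa> * ?E \<kappa> \<nu> = 0" if "\<kappa> \<in> U - {\<nu>}" for \<kappa>
    using leading_keys[OF lead[of \<kappa>], of \<nu>] that \<nu>(2)[of \<kappa>] by (fastforce simp: W_def)
  then have "(\<Sum>\<mu>\<in>U - {\<nu>}. \<Lambda> \<mu> * ?E \<mu> \<nu>) = 0" by (rule sum.neutral[OF ballI])
  then have "f \<nu> = \<Lambda> \<nu> * ?E \<nu> \<nu>"
    using fs[of \<nu>] le U(1) \<nu>(1) by (simp add: sum.remove[of U \<nu>] W_def)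
  also have "\<dots> \<noteq> 0"
    using lead[of \<nu>] \<nu>(1) by (auto simp: leading_def W_def)
  finally have "?d \<nu> \<le> ?d m" by (rule max)
  \<comment> \<open>The degrees of \<open>m\<close>, \<open>\<mu>\<close> and \<open>\<nu>\<close>
    now coincide, and the only monomial of \<open>E_elt C r i \<mu>\<close> in the degree of
    \<open>\<mu>\<close> is \<open>\<mu>\<close> itself.\<close>
  with le have "\<mu> = m"
    using leading_keys[OF lead[OF \<mu>(1)] \<mu>'(2)] by auto
  with \<mu>(1) U(2) show ?thesis by auto
qed

theorem lemma5p7:
  fixes C :: "int ^ 'i::{finite,linorder} ^ 'i::{finite,linorder}"
    and r :: "'i \<Rightarrow> nat"
    and J :: "'i set"
    and f :: "'i mon \<Rightarrow> lau"
  assumes "finite_type_Cartan C"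
    and "Cartan_symmetrizer C r"
    and "f \<in> K_inf C r J"
    and "f \<noteq> (\<lambda>_. 0)"
  shows "\<exists>m. m \<in> monomials f \<and> m \<in> dominant J"
proof -
  obtain w :: "'i \<Rightarrow> real" where w: "\<And>i. (\<Sum>j\<in>UNIV. of_int (C $ j $ i) * w j) = 1"
    using finite_type_Cartan_weights[OF assms(1)] by blast
  have deg: "mon_deg w (Amon C r j l) = 1" for j l
    using mon_deg_Amon[OF assms(1)] w by simp
  have f: "f \<in> Yt_inf C r" "\<And>i. i \<in> J \<Longrightarrow> f \<in> K_inf_single C r i"
    using assms(3) by (auto simp: K_inf_def)
  obtain S where S: "finite S"
    "\<And>m. f m \<noteq> 0 \<Longrightarrow> \<exists>M\<in>S. \<exists>K::nat. mon_deg w m = mon_deg w M - real K"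
    using Yt_inf_degrees[OF deg f(1)] by blast
  obtain m\<^sub>0 where "f m\<^sub>0 \<noteq> 0" using assms(4) by auto
  \<comment> \<open>This choice depends on \<open>f\<close> alone, so the same \<open>m\<close>
    serves every \<open>i\<close> in \<open>J\<close>, and an empty \<open>J\<close> is covered
    too.\<close>
  then obtain m where m: "f m \<noteq> 0" "\<And>m'. f m' \<noteq> 0 \<Longrightarrow> mon_deg w m' \<le> mon_deg w m"
    using ex_max_degree[of S "\<lambda>m. f m \<noteq> 0" m\<^sub>0 "mon_deg w" "mon_deg w"] S by blast
  have "m \<in> dominant {i}" if "i \<in> J" for i
    using max_degree_dominant[OF deg f(2)[OF that]] m by blast
  with m(1) show ?thesis
    by (auto simp: monomials_def dominant_def)
qed

end
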